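(* Let $a\in\mathbb{C}$ and let $z\neq 0$ be a point of the Riemann surface of the logarithm. For each non-negative integer $N$, define $R_N^{(\mathrm f)}(a,z)$ and $R_N^{(\mathrm g)}(a,z)$ by $$\mathrm{f}(a, z) = z^{a - 1} \left( \sum_{n = 0}^{N - 1} (-1)^n \frac{(1 - a)_{2n}}{z^{2n}} + R_N^{(\mathrm f)}(a,z) \right),$$ $$\mathrm{g}(a, z) = z^{a - 1} \left( \sum_{n = 0}^{N - 1} (-1)^n \frac{(1 - a)_{2n + 1}}{z^{2n + 1}} + R_N^{(\mathrm g)}(a,z) \right).$$ Then $$R_N^{(\mathrm f)}(a,z)=(-1)^N \frac{(1 - a)_{2N}}{z^{2N}}\, \Pi_{2N + 1 - a}(z)\quad\text{provided } 2N+1>\operatorname{Re}(a),$$ and $$R_N^{(\mathrm g)}(a,z) = (-1)^N \frac{(1 - a)_{2N + 1}}{z^{2N + 1}}\, \Pi_{2N + 2 - a}(z)\quad\text{provided } 2N+2>\operatorname{Re}(a).$$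
   Context: $\Gamma(a,z)$ is the (upper) incomplete gamma function, equal to $\int_z^\infty t^{a-1}e^{-t}\,dt$ (principal branch for $|\arg z|<\pi$) and continued analytically in $z$ to the Riemann surface of the logarithm; it is entire in $a$. $(x)_n=x(x+1)\cdots(x+n-1)$, $(x)_0=1$, is the Pochhammer symbol. The auxiliary functions are $$\mathrm{f}(a, z) = \frac{1}{2i} e^{\frac{\pi}{2} i a} e^{-i z}\, \Gamma(a, z e^{-\frac{\pi}{2} i}) - \frac{1}{2i} e^{-\frac{\pi}{2} i a} e^{i z}\, \Gamma(a, z e^{\frac{\pi}{2} i}),$$ $$\mathrm{g}(a, z) = \frac{1}{2} e^{\frac{\pi}{2} i a} e^{-i z}\, \Gamma(a, z e^{-\frac{\pi}{2} i}) + \frac{1}{2} e^{-\frac{\pi}{2} i a} e^{i z}\, \Gamma(a, z e^{\frac{\pi}{2} i}).$$ They are entire in $a$ and in general multivalued in $z$ with a branch point at $z=0$; here $ze^{\pm\pi i/2}$ denotes the point with argument $\arg z\pm\pi/2$. For $\operatorname{Re}(p)>0$ the basic terminant is $\Pi_p(z)=z^p\,\mathrm{f}(1-p,z)$, with $z^p = e^{p\log z}$ for the value of $\log z$ at the given point of the Riemann surface. *)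

theory Defs
  imports "HOL-Complex_Analysis.Complex_Analysis" "HOL-Real_Asymp.Real_Asymp"
begin

text \<open>
  A point of the Riemann surface of the logarithm is represented by its logarithm
  \<open>\<zeta> :: complex\<close>, which is a global coordinate on that surface: the underlying nonzero complex
  number is \<open>z = exp \<zeta>\<close>, the argument is \<open>Im \<zeta>\<close> (any real number), the point
  \<open>z e\<^sup>i\<^sup>\<theta>\<close> is \<open>\<zeta> + \<i> \<theta>\<close>, and \<open>z\<^sup>p\<close> is \<open>exp (p * \<zeta>)\<close>. Analytic functions on the surface are
  entire functions of \<open>\<zeta>\<close>, and the sector \<open>\<bar>arg z\<bar> < \<pi>\<close> is the strip \<open>\<bar>Im \<zeta>\<bar> < pi\<close>.
\<close>

text \<open>
  The path from \<open>z\<close> to infinity is the horizontal ray \<open>z + s\<close>, \<open>s \<ge> 0\<close>. For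
  \<open>z \<notin> \<real>\<^sub>\<le>\<^sub>0\<close> it avoids the branch cut of \<open>powr\<close>.
\<close>
definition inc_Gamma_principal :: "complex \<Rightarrow> complex \<Rightarrow> complex" where
  "inc_Gamma_principal a z =
     integral {0..} (\<lambda>s::real. (z + of_real s) powr (a - 1) * exp (- (z + of_real s)))"

definition inc_Gamma :: "complex \<Rightarrow> complex \<Rightarrow> complex" where
  "inc_Gamma a = (THE G. G holomorphic_on UNIV \<and>
     (\<forall>\<zeta>. \<bar>Im \<zeta>\<bar> < pi \<longrightarrow> G \<zeta> = inc_Gamma_principal a (exp \<zeta>)))"

lemma powr_exp_bound:
  fixes b z :: complex and s :: real and u :: complex
  assumes s: "s \<ge> norm z + 1" and u: "u \<in> closed_segment (of_real s) (z + of_real s)"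
  shows "u \<notin> \<real>\<^sub>\<le>\<^sub>0"
    and "norm (u powr b * exp (- u))
           \<le> exp (norm b * pi) * (s + norm z) powr norm b * exp (norm z - s)"
proof -
  obtain t where t: "0 \<le> t" "t \<le> 1" and u_eq: "u = of_real s + of_real t * z"
    using u by (auto simp: closed_segment_def algebra_simps scaleR_conv_of_real)
  have ntz: "norm (of_real t * z) \<le> norm z"
    using t by (simp add: norm_mult mult_left_le_one_le)
  have re: "Re u \<ge> s - norm z"
    using ntz abs_Re_le_cmod[of "of_real t * z"] by (simp add: u_eq)
  have up: "norm u \<le> s + norm z"
  proof -
    have "norm u \<le> norm (of_real s :: complex) + norm (of_real t * z)"
      unfolding u_eq by (rule norm_triangle_ineq)
    also have "norm (of_real s :: complex) = s"
      using s norm_ge_zero[of z] unfolding norm_of_real by linarith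
    finally show ?thesis using ntz by linarith
  qed
  have re1: "Re u \<ge> 1" using re s by linarith
  have n1: "norm u \<ge> 1" using re1 complex_Re_le_cmod[of u] by linarith
  show "u \<notin> \<real>\<^sub>\<le>\<^sub>0" using re1 by (auto simp: complex_nonpos_Reals_iff)
  have u0: "u \<noteq> 0" using n1 by auto
  have "norm (Ln u) \<le> \<bar>Re (Ln u)\<bar> + \<bar>Im (Ln u)\<bar>" by (rule cmod_le)
  also have "\<dots> \<le> ln (s + norm z) + pi"
  proof (rule add_mono)
    show "\<bar>Re (Ln u)\<bar> \<le> ln (s + norm z)" using u0 n1 up by simp
    show "\<bar>Im (Ln u)\<bar> \<le> pi" using Im_Ln_le_pi[OF u0] mpi_less_Im_Ln[OF u0] by linarith
  qed
  finally have L: "norm (Ln u) \<le> ln (s + norm z) + pi" .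
  have "norm (u powr b) = exp (Re (b * Ln u))" using u0 by (simp add: powr_def)
  also have "Re (b * Ln u) \<le> norm b * norm (Ln u)"
    using complex_Re_le_cmod[of "b * Ln u"] by (simp only: norm_mult)
  also have "norm b * norm (Ln u) \<le> norm b * (ln (s + norm z) + pi)"
    by (rule mult_left_mono[OF L]) simp
  finally have "norm (u powr b) \<le> exp (norm b * (ln (s + norm z) + pi))" by simp
  also have "\<dots> = exp (norm b * pi) * (s + norm z) powr norm b"
    using n1 up by (auto simp: powr_def distrib_left exp_add mult_ac)
  finally have A: "norm (u powr b) \<le> exp (norm b * pi) * (s + norm z) powr norm b" .
  have B: "norm (exp (- u)) \<le> exp (norm z - s)" using re by simp
  show "norm (u powr b * exp (- u))
           \<le> exp (norm b * pi) * (s + norm z) powr norm b * exp (norm z - s)"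
    unfolding norm_mult by (rule mult_mono[OF A B]) auto
qed

lemma add_of_real_notin_nonpos_Reals:
  fixes z :: complex
  assumes "z \<notin> \<real>\<^sub>\<le>\<^sub>0" "s \<ge> 0"
  shows "z + of_real s \<notin> \<real>\<^sub>\<le>\<^sub>0"
  using assms by (auto simp: complex_nonpos_Reals_iff)

lemma inc_Gamma_principal_tendsto:
  fixes a z :: complex
  assumes z: "z \<notin> \<real>\<^sub>\<le>\<^sub>0"
  defines "h \<equiv> \<lambda>s::real. (z + of_real s) powr (a - 1) * exp (- (z + of_real s))"
  shows "((\<lambda>S. integral {0..S} h) \<longlongrightarrow> inc_Gamma_principal a z) at_top"
proof -
  have cont: "continuous_on {0..} h"
  proof (rule continuous_at_imp_continuous_on, rule ballI)
    fix s :: real assume "s \<in> {0..}"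
    hence "z + of_real s \<notin> \<real>\<^sub>\<le>\<^sub>0" using add_of_real_notin_nonpos_Reals[OF z] by auto
    thus "isCont h s" unfolding h_def by (intro continuous_intros) auto
  qed
  define k c where "k = norm (a - 1)" and "c = norm z"
  have "((\<lambda>s::real. exp (k * pi) * (s + c) powr k * exp (c - s) / exp (- (1/2) * s)) \<longlongrightarrow> 0) at_top"
    by real_asymp
  hence "eventually (\<lambda>s::real. exp (k * pi) * (s + c) powr k * exp (c - s) / exp (- (1/2) * s) < 1) at_top"
    by (rule order_tendstoD) simp
  then obtain s0 where s0: "\<And>s. s \<ge> s0 \<Longrightarrow>
      exp (k * pi) * (s + c) powr k * exp (c - s) / exp (- (1/2) * s) < 1"
    by (auto simp: eventually_at_top_linorder)
  define s1 where "s1 = max s0 (c + 1)"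
  have s1: "s1 \<ge> 0" by (simp add: s1_def c_def max.coboundedI2)
  have bound: "norm (h s) \<le> exp (- (1/2) * s)" if "s \<ge> s1" for s
  proof -
    have "norm (h s) \<le> exp (k * pi) * (s + c) powr k * exp (c - s)"
      unfolding h_def k_def c_def
      by (rule powr_exp_bound(2)) (use that in \<open>auto simp: s1_def c_def\<close>)
    also have "\<dots> \<le> exp (- (1/2) * s)"
      using s0[of s] that by (simp add: s1_def divide_simps)
    finally show ?thesis .
  qed
  have "set_integrable lborel ({0..s1} \<union> {s1..}) h"
  proof (rule set_integrable_Un)
    show "set_integrable lborel {0..s1} h"
      by (rule borel_integrable_atLeastAtMost')
         (rule continuous_on_subset[OF cont], auto)
    have int: "set_integrable lborel {s1..} (\<lambda>s::real. exp (- (1/2) * s))"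
    proof -
      have "set_integrable lebesgue {s1..} (\<lambda>s::real. exp (- (1/2) * s))"
        by (rule nonnegative_absolutely_integrable_1)
           (auto intro: integrable_on_exp_minus_to_infinity[of "1/2", simplified])
      thus ?thesis
        unfolding set_integrable_def by (subst (asm) integrable_completion) auto
    qed
    show "set_integrable lborel {s1..} h"
    proof (rule set_integrable_bound[OF int])
      show "set_borel_measurable lborel {s1..} h"
        unfolding set_borel_measurable_def
        using borel_measurable_continuous_on_indicator[of "{s1..}" h]
              continuous_on_subset[OF cont, of "{s1..}"] s1 by auto
    qed (use bound in auto)
  qed auto
  moreover have "{0..s1} \<union> {s1..} = {0..}" using s1 by auto
  ultimately have int: "set_integrable lborel {0..} h" by simp
  have "((\<lambda>S. LINT s:{0..S}|lborel. h s) \<longlongrightarrow> (LINT s:{0..}|lborel. h s)) at_top"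
    by (rule tendsto_set_lebesgue_integral_at_top[OF _ int]) auto
  moreover have "(LINT s:{0..}|lborel. h s) = inc_Gamma_principal a z"
    using set_borel_integral_eq_integral(2)[OF int]
    by (simp add: inc_Gamma_principal_def h_def)
  moreover have "(LINT s:{0..S}|lborel. h s) = integral {0..S} h" for S
    by (rule set_borel_integral_eq_integral(2), rule set_integrable_subset[OF int]) auto
  ultimately show ?thesis by simp
qed

text \<open>
  The analytic continuation denoted by \<^const>\<open>inc_Gamma\<close> exists and is unique, so the definite
  description is well-defined.
\<close>
lemma ex1_inc_Gamma:
  "\<exists>!G. G holomorphic_on UNIV \<and>
     (\<forall>\<zeta>. \<bar>Im \<zeta>\<bar> < pi \<longrightarrow> G \<zeta> = inc_Gamma_principal a (exp \<zeta>))"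
proof (rule ex_ex1I)
  fix G H
  assume G: "G holomorphic_on UNIV \<and>
      (\<forall>\<zeta>. \<bar>Im \<zeta>\<bar> < pi \<longrightarrow> G \<zeta> = inc_Gamma_principal a (exp \<zeta>))"
    and H: "H holomorphic_on UNIV \<and>
      (\<forall>\<zeta>. \<bar>Im \<zeta>\<bar> < pi \<longrightarrow> H \<zeta> = inc_Gamma_principal a (exp \<zeta>))"
  show "G = H"
  proof
    fix \<zeta>
    have ball: "\<bar>Im w\<bar> < pi" if "w \<in> ball 0 1" for w
      using that abs_Im_le_cmod[of w] pi_gt3 by simp
    show "G \<zeta> = H \<zeta>"
      by (rule analytic_continuation_open[of "ball 0 1" UNIV]) (use G H ball in auto)
  qed
next
  define h where "h = (\<lambda>u::complex. u powr (a - 1) * exp (- u))"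
  have "(\<lambda>w. exp (a * w - exp w)) holomorphic_on UNIV" by (intro holomorphic_intros)
  then obtain P where P: "\<And>w. (P has_field_derivative exp (a * w - exp w)) (at w)"
    using holomorphic_convex_primitive'[of UNIV "\<lambda>w. exp (a * w - exp w)"] by auto
  define Q where "Q = (\<lambda>u. P (Ln u))"
  have Q: "(Q has_field_derivative h u) (at u)" if "u \<notin> \<real>\<^sub>\<le>\<^sub>0" for u
  proof -
    have "u \<noteq> 0" using that by auto
    have "(Q has_field_derivative exp (a * Ln u - exp (Ln u)) * inverse u) (at u)"
      unfolding Q_def by (rule DERIV_chain2[OF P has_field_derivative_Ln[OF that]])
    also have "exp (a * Ln u - exp (Ln u)) * inverse u = h u"
      using \<open>u \<noteq> 0\<close> by (simp add: h_def powr_def exp_diff exp_minus left_diff_distrib field_simps)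
    finally show ?thesis .
  qed
  have int: "integral {0..S} (\<lambda>s. (z + of_real s) powr (a - 1) * exp (- (z + of_real s)))
               = Q (z + of_real S) - Q z" if z: "z \<notin> \<real>\<^sub>\<le>\<^sub>0" and S: "S \<ge> 0" for z :: complex and S :: real
  proof (rule integral_unique)
    have "((\<lambda>s. h (z + of_real s)) has_integral Q (z + of_real S) - Q (z + of_real 0)) {0..S}"
    proof (rule fundamental_theorem_of_calculus[OF S])
      fix s :: real assume "s \<in> {0..S}"
      hence "z + of_real s \<notin> \<real>\<^sub>\<le>\<^sub>0" using add_of_real_notin_nonpos_Reals[OF z] by auto
      note Q[OF this]
      then have "((\<lambda>w. Q (z + w)) has_field_derivative h (z + of_real s)) (at (of_real s))"
      proof -
        have "((\<lambda>w. z + w) has_field_derivative 1) (at (of_real s))"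
          by (auto intro!: derivative_eq_intros)
        from DERIV_chain2[OF \<open>(Q has_field_derivative _) _\<close> this] show ?thesis by simp
      qed
      thus "((\<lambda>s. Q (z + of_real s)) has_vector_derivative h (z + of_real s)) (at s within {0..S})"
        by (rule has_vector_derivative_real_field)
    qed
    thus "((\<lambda>s. (z + of_real s) powr (a - 1) * exp (- (z + of_real s)))
            has_integral Q (z + of_real S) - Q z) {0..S}"
      by (simp add: h_def)
  qed
  have lim: "((\<lambda>S. Q (z + of_real S)) \<longlongrightarrow> inc_Gamma_principal a z + Q z) at_top"
    if z: "z \<notin> \<real>\<^sub>\<le>\<^sub>0" for z
  proof -
    have "((\<lambda>S. Q (z + of_real S) - Q z) \<longlongrightarrow> inc_Gamma_principal a z) at_top"
    proof (rule Lim_transform_eventually[OF inc_Gamma_principal_tendsto[OF z]])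
      show "eventually (\<lambda>S. integral {0..S} (\<lambda>s. (z + of_real s) powr (a - 1) * exp (- (z + of_real s)))
              = Q (z + of_real S) - Q z) at_top"
        using eventually_ge_at_top[of 0] by eventually_elim (rule int[OF z])
    qed
    from tendsto_add[OF this tendsto_const[of "Q z"]] show ?thesis by simp
  qed
  have diff: "((\<lambda>S. Q (z + of_real S) - Q (of_real S)) \<longlongrightarrow> 0) at_top" for z
  proof (rule Lim_null_comparison)
    define k c where "k = norm (a - 1)" and "c = norm z"
    show "((\<lambda>S::real. exp (k * pi) * (S + c) powr k * exp (c - S) * c) \<longlongrightarrow> 0) at_top"
      by real_asymp
    show "eventually (\<lambda>S. norm (Q (z + of_real S) - Q (of_real S))
             \<le> exp (k * pi) * (S + c) powr k * exp (c - S) * c) at_top"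
      using eventually_ge_at_top[of "c + 1"]
    proof eventually_elim
      case (elim S)
      have "norm (Q (z + of_real S) - Q (of_real S))
              \<le> exp (k * pi) * (S + c) powr k * exp (c - S) * norm (z + of_real S - of_real S)"
      proof (rule field_differentiable_bound[where f' = h and S = "closed_segment (of_real S) (z + of_real S)"])
        fix u assume u: "u \<in> closed_segment (of_real S) (z + of_real S)"
        note b = powr_exp_bound[OF elim[unfolded c_def] u]
        show "(Q has_field_derivative h u) (at u within closed_segment (of_real S) (z + of_real S))"
          by (rule has_field_derivative_at_within[OF Q[OF b(1)]])
        show "norm (h u) \<le> exp (k * pi) * (S + c) powr k * exp (c - S)"
          unfolding h_def k_def c_def by (rule b(2))
      qed auto
      thus ?case by (simp add: c_def)
    qed
  qed
  define L where "L = inc_Gamma_principal a 1 + Q 1"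
  have L: "inc_Gamma_principal a z + Q z = L" if z: "z \<notin> \<real>\<^sub>\<le>\<^sub>0" for z
  proof -
    have "((\<lambda>S. Q (1 + of_real S) - (Q (1 + of_real S) - Q (of_real S))
              + (Q (z + of_real S) - Q (of_real S))) \<longlongrightarrow> L - 0 + 0) at_top"
      unfolding L_def by (intro tendsto_intros lim diff) auto
    hence "((\<lambda>S. Q (z + of_real S)) \<longlongrightarrow> L) at_top" by simp
    with lim[OF z] show ?thesis by (rule tendsto_unique[rotated]) simp
  qed
  show "\<exists>G. G holomorphic_on UNIV \<and>
      (\<forall>\<zeta>. \<bar>Im \<zeta>\<bar> < pi \<longrightarrow> G \<zeta> = inc_Gamma_principal a (exp \<zeta>))"
  proof (intro exI[of _ "\<lambda>w. L - P w"] conjI allI impI)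
    have "P holomorphic_on UNIV" using P by (auto simp: holomorphic_on_open)
    thus "(\<lambda>w. L - P w) holomorphic_on UNIV" by (intro holomorphic_intros)
    fix \<zeta> :: complex assume strip: "\<bar>Im \<zeta>\<bar> < pi"
    have ln: "Ln (exp \<zeta>) = \<zeta>" using strip by (intro Ln_exp) auto
    have "exp \<zeta> \<notin> \<real>\<^sub>\<le>\<^sub>0"
    proof
      assume "exp \<zeta> \<in> \<real>\<^sub>\<le>\<^sub>0"
      hence "Im (Ln (exp \<zeta>)) = pi"
        using Im_Ln_eq_pi[of "exp \<zeta>"] exp_not_eq_zero[of \<zeta>]
        by (simp only: complex_nonpos_Reals_iff complex_eq_iff order_less_le) simp
      thus False using ln strip by simp
    qed
    from L[OF this] show "L - P \<zeta> = inc_Gamma_principal a (exp \<zeta>)"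
      by (simp add: Q_def ln algebra_simps)
  qed
qed

lemma inc_Gamma_holomorphic: "inc_Gamma a holomorphic_on UNIV"
  and inc_Gamma_eq_principal:
    "\<bar>Im \<zeta>\<bar> < pi \<Longrightarrow> inc_Gamma a \<zeta> = inc_Gamma_principal a (exp \<zeta>)"
  using theI'[OF ex1_inc_Gamma[of a]] unfolding inc_Gamma_def by blast+

definition f_aux :: "complex \<Rightarrow> complex \<Rightarrow> complex" where
  "f_aux a \<zeta> =
     1 / (2 * \<i>) * exp (of_real pi / 2 * \<i> * a) * exp (- \<i> * exp \<zeta>)
       * inc_Gamma a (\<zeta> - of_real pi / 2 * \<i>)
     - 1 / (2 * \<i>) * exp (- (of_real pi / 2) * \<i> * a) * exp (\<i> * exp \<zeta>)
       * inc_Gamma a (\<zeta> + of_real pi / 2 * \<i>)"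

definition g_aux :: "complex \<Rightarrow> complex \<Rightarrow> complex" where
  "g_aux a \<zeta> =
     1 / 2 * exp (of_real pi / 2 * \<i> * a) * exp (- \<i> * exp \<zeta>)
       * inc_Gamma a (\<zeta> - of_real pi / 2 * \<i>)
     + 1 / 2 * exp (- (of_real pi / 2) * \<i> * a) * exp (\<i> * exp \<zeta>)
       * inc_Gamma a (\<zeta> + of_real pi / 2 * \<i>)"

text \<open>Only meaningful for \<open>Re p > 0\<close>.\<close>
definition basic_terminant :: "complex \<Rightarrow> complex \<Rightarrow> complex" where
  "basic_terminant p \<zeta> = exp (p * \<zeta>) * f_aux (1 - p) \<zeta>"

end

theory Submission
  imports Defs
begin

text \<open>
  Integration by parts gives \<open>\<Gamma>(a + 1, z) = a \<Gamma>(a, z) + z\<^sup>a e\<^sup>-\<^sup>z\<close>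
  (lemma \<open>inc_Gamma_recurrence\<close>). At \<open>z e\<^sup>\<mp>\<^sup>\<pi>\<^sup>i\<^sup>/\<^sup>2\<close> the exponential factors in the definitions of
  \<open>f\<close> and \<open>g\<close> turn the inhomogeneous term into the pure power \<open>z\<^sup>a\<close> for both summands, so that the
  sum and the difference of the two recurrences read
  \<open>f(a + 1, z) = a g(a, z) + z\<^sup>a\<close> and \<open>g(a + 1, z) = - a f(a, z)\<close>.
  Eliminating \<open>g\<close> lowers the first parameter of \<open>f\<close> by two:
  \<open>f(a, z) = z\<^bsup>a - 1\<^esup> - (1 - a)(2 - a) f(a - 2, z)\<close>. Iterating this \<open>N\<close> times
  (lemma \<open>f_aux_expansion\<close>) produces \<open>z\<^bsup>a - 1\<^esup>\<close> times the truncated series, with the remainder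
  \<open>(-1)\<^sup>N (1 - a)\<^bsub>2N\<^esub> f(a - 2N, z)\<close>, which is a basic terminant up to a power of \<open>z\<close>. The
  expansion of \<open>g(a, z) = (1 - a) f(a - 1, z)\<close> is then that of \<open>f\<close> at \<open>a - 1\<close>.
\<close>

lemma exp_strip_notin_nonpos_Reals:
  assumes "\<bar>Im \<zeta>\<bar> < pi"
  shows "exp \<zeta> \<notin> \<real>\<^sub>\<le>\<^sub>0"
proof
  assume "exp \<zeta> \<in> \<real>\<^sub>\<le>\<^sub>0"
  hence "Im (Ln (exp \<zeta>)) = pi"
    using Im_Ln_eq_pi[of "exp \<zeta>"] exp_not_eq_zero[of \<zeta>]
    by (simp only: complex_nonpos_Reals_iff complex_eq_iff order_less_le) simp
  moreover have "Ln (exp \<zeta>) = \<zeta>" using assms by (intro Ln_exp) auto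
  ultimately show False using assms by simp
qed

lemma powr_mult_exp_tendsto_0:
  fixes a z :: complex
  shows "((\<lambda>s::real. (z + of_real s) powr a * exp (- (z + of_real s))) \<longlongrightarrow> 0) at_top"
proof (rule Lim_null_comparison)
  define k c where "k = norm a" and "c = norm z"
  show "((\<lambda>s::real. exp (k * pi) * (s + c) powr k * exp (c - s)) \<longlongrightarrow> 0) at_top"
    by real_asymp
  show "eventually (\<lambda>s. norm ((z + of_real s) powr a * exp (- (z + of_real s)))
          \<le> exp (k * pi) * (s + c) powr k * exp (c - s)) at_top"
    using eventually_ge_at_top[of "c + 1"]
  proof eventually_elim
    case (elim s)
    show ?case
      unfolding k_def c_def by (rule powr_exp_bound(2)) (use elim in \<open>auto simp: c_def\<close>)
  qed
qed

text \<open>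
  Integration by parts over \<open>[z, z + S]\<close>, followed by \<open>S \<rightarrow> \<infinity>\<close>, where the boundary term at
  \<open>z + S\<close> vanishes.
\<close>
lemma inc_Gamma_principal_recurrence:
  fixes a z :: complex
  assumes z: "z \<notin> \<real>\<^sub>\<le>\<^sub>0"
  shows "inc_Gamma_principal (a + 1) z = a * inc_Gamma_principal a z + z powr a * exp (- z)"
proof -
  define F where "F = (\<lambda>s::real. (z + of_real s) powr a * exp (- (z + of_real s)))"
  define h where "h = (\<lambda>s::real. (z + of_real s) powr (a - 1) * exp (- (z + of_real s)))"
  have parts: "a * integral {0..S} h - integral {0..S} F = F S - F 0" if S: "S \<ge> 0" for S
  proof -
    have notin: "z + of_real s \<notin> \<real>\<^sub>\<le>\<^sub>0" if "s \<in> {0..S}" for s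
      using add_of_real_notin_nonpos_Reals[OF z] that by auto
    have "isCont h s" "isCont F s" if "s \<in> {0..S}" for s
      unfolding h_def F_def using notin[OF that] by (auto intro!: continuous_intros)
    hence int: "h integrable_on {0..S}" "F integrable_on {0..S}"
      by (auto intro!: integrable_continuous_interval continuous_at_imp_continuous_on)
    have "((\<lambda>s. a * h s - F s) has_integral F S - F 0) {0..S}"
    proof (rule fundamental_theorem_of_calculus[OF S])
      fix s :: real assume s: "s \<in> {0..S}"
      have "((\<lambda>w. (z + w) powr a * exp (- (z + w))) has_field_derivative a * h s - F s)
              (at (of_real s))"
        using notin[OF s]
        by (auto intro!: derivative_eq_intros simp: h_def F_def algebra_simps minus_diff_commute)
      thus "(F has_vector_derivative a * h s - F s) (at s within {0..S})"
        unfolding F_def by (rule has_vector_derivative_real_field)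
    qed
    from integral_unique[OF this] show ?thesis
      using int by (simp add: integral_diff integrable_on_mult_right)
  qed
  have "((\<lambda>S. a * integral {0..S} h - (F S - F 0)) \<longlongrightarrow> a * inc_Gamma_principal a z - (0 - F 0)) at_top"
    using inc_Gamma_principal_tendsto[OF z, of a] powr_mult_exp_tendsto_0[of z a]
    unfolding h_def F_def by (intro tendsto_intros)
  moreover have "eventually (\<lambda>S. a * integral {0..S} h - (F S - F 0) = integral {0..S} F) at_top"
    using eventually_ge_at_top[of 0] by eventually_elim (simp add: parts[symmetric])
  ultimately have "((\<lambda>S. integral {0..S} F) \<longlongrightarrow> a * inc_Gamma_principal a z + F 0) at_top"
    by (auto dest: Lim_transform_eventually)
  moreover have "((\<lambda>S. integral {0..S} F) \<longlongrightarrow> inc_Gamma_principal (a + 1) z) at_top"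
    using inc_Gamma_principal_tendsto[OF z, of "a + 1"] by (simp add: F_def)
  ultimately have "inc_Gamma_principal (a + 1) z = a * inc_Gamma_principal a z + F 0"
    by (intro tendsto_unique[of at_top]) auto
  thus ?thesis by (simp add: F_def)
qed

text \<open>
  Both sides are entire in the logarithmic coordinate \<open>\<zeta>\<close>, so the recurrence on the principal
  sheet extends to the whole Riemann surface.
\<close>
lemma inc_Gamma_recurrence:
  "inc_Gamma (a + 1) \<zeta> = a * inc_Gamma a \<zeta> + exp (a * \<zeta> - exp \<zeta>)"
proof (rule analytic_continuation_open[where s = "ball 0 1" and s' = UNIV
      and f = "inc_Gamma (a + 1)" and g = "\<lambda>\<zeta>. a * inc_Gamma a \<zeta> + exp (a * \<zeta> - exp \<zeta>)"])
  show "inc_Gamma (a + 1) holomorphic_on UNIV" by (rule inc_Gamma_holomorphic)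
  show "(\<lambda>\<zeta>. a * inc_Gamma a \<zeta> + exp (a * \<zeta> - exp \<zeta>)) holomorphic_on UNIV"
    by (intro holomorphic_intros inc_Gamma_holomorphic)
  fix w :: complex assume "w \<in> ball 0 1"
  hence strip: "\<bar>Im w\<bar> < pi" using abs_Im_le_cmod[of w] pi_gt3 by simp
  hence "Ln (exp w) = w" by (intro Ln_exp) auto
  hence "exp w powr a * exp (- exp w) = exp (a * w - exp w)"
    by (simp add: powr_def exp_diff exp_minus divide_inverse)
  thus "inc_Gamma (a + 1) w = a * inc_Gamma a w + exp (a * w - exp w)"
    using inc_Gamma_principal_recurrence[OF exp_strip_notin_nonpos_Reals[OF strip]]
    by (simp add: inc_Gamma_eq_principal[OF strip])
qed auto

text \<open>
  Treats both summands of \<open>f\<close> and \<open>g\<close> at once. At the rotated point \<open>-\<epsilon> z\<close> the inhomogeneous term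
  of the recurrence is \<open>(-\<epsilon> z)\<^sup>a e\<^bsup>\<epsilon> z\<^esup>\<close>; the prefactor \<open>e\<^bsup>-\<epsilon> z\<^esup>\<close> cancels the exponential and
  \<open>e\<^bsup>\<epsilon> \<pi> a / 2\<^esup>\<close> cancels the phase of the power, leaving \<open>z\<^sup>a\<close>. The outer \<open>\<epsilon>\<close> is the change
  \<open>e\<^bsup>\<epsilon> \<pi> / 2\<^esup>\<close> of that phase factor when \<open>a\<close> increases by one.
\<close>
lemma rotated_inc_Gamma_recurrence:
  fixes \<epsilon> \<zeta> :: complex
  assumes \<epsilon>: "\<epsilon> = \<i> \<or> \<epsilon> = - \<i>"
  defines "T \<equiv> \<lambda>a. exp (of_real pi / 2 * \<epsilon> * a) * exp (- \<epsilon> * exp \<zeta>)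
                     * inc_Gamma a (\<zeta> - of_real pi / 2 * \<epsilon>)"
  shows "T (a + 1) = \<epsilon> * (a * T a + exp (a * \<zeta>))"
proof -
  have half: "exp (of_real pi / 2 * \<epsilon>) = \<epsilon>"
    using \<epsilon> by (auto simp: complex_eq_iff Re_exp Im_exp)
  have neg_half: "exp (\<zeta> - of_real pi / 2 * \<epsilon>) = - \<epsilon> * exp \<zeta>"
    unfolding exp_diff half using \<epsilon> by (auto simp: field_simps)
  have cancel: "exp (of_real pi / 2 * \<epsilon> * a) * exp (- \<epsilon> * exp \<zeta>)
          * exp (a * (\<zeta> - of_real pi / 2 * \<epsilon>) - (- \<epsilon> * exp \<zeta>)) = exp (a * \<zeta>)"
    unfolding exp_add[symmetric] by (rule arg_cong[where f = exp]) (simp add: algebra_simps)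
  have "exp (of_real pi / 2 * \<epsilon> * (a + 1)) = \<epsilon> * exp (of_real pi / 2 * \<epsilon> * a)"
    by (simp only: distrib_left exp_add half mult_1_right) (simp only: mult.commute)
  hence "T (a + 1) = \<epsilon> * (a * T a + exp (of_real pi / 2 * \<epsilon> * a) * exp (- \<epsilon> * exp \<zeta>)
          * exp (a * (\<zeta> - of_real pi / 2 * \<epsilon>) - (- \<epsilon> * exp \<zeta>)))"
    unfolding T_def inc_Gamma_recurrence neg_half by (simp only: algebra_simps)
  thus ?thesis unfolding cancel .
qed

lemma f_aux_add_1: "f_aux (a + 1) \<zeta> = a * g_aux a \<zeta> + exp (a * \<zeta>)"
  and g_aux_add_1: "g_aux (a + 1) \<zeta> = - a * f_aux a \<zeta>"
proof -
  define T where "T = (\<lambda>\<epsilon> a. exp (of_real pi / 2 * \<epsilon> * a) * exp (- \<epsilon> * exp \<zeta>)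
                     * inc_Gamma a (\<zeta> - of_real pi / 2 * \<epsilon>))"
  have rec: "T \<i> (a + 1) = \<i> * (a * T \<i> a + exp (a * \<zeta>))"
    "T (- \<i>) (a + 1) = - \<i> * (a * T (- \<i>) a + exp (a * \<zeta>))"
    unfolding T_def by (rule rotated_inc_Gamma_recurrence; simp)+
  have f: "f_aux b \<zeta> = (T \<i> b - T (- \<i>) b) / (2 * \<i>)" for b
    by (simp add: f_aux_def T_def field_simps)
  have g: "g_aux b \<zeta> = (T \<i> b + T (- \<i>) b) / 2" for b
    by (simp add: g_aux_def T_def field_simps)
  show "f_aux (a + 1) \<zeta> = a * g_aux a \<zeta> + exp (a * \<zeta>)"
    unfolding f g rec by (simp add: field_simps)
  show "g_aux (a + 1) \<zeta> = - a * f_aux a \<zeta>"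
    unfolding f g rec by (simp add: field_simps)
qed

lemma g_aux_eq_f_aux: "g_aux a \<zeta> = (1 - a) * f_aux (a - 1) \<zeta>"
  using g_aux_add_1[of "a - 1" \<zeta>] by simp

lemma f_aux_minus_2: "f_aux a \<zeta> = exp ((a - 1) * \<zeta>) - (1 - a) * (2 - a) * f_aux (a - 2) \<zeta>"
  using f_aux_add_1[of "a - 1" \<zeta>] g_aux_eq_f_aux[of "a - 1" \<zeta>] by (simp add: algebra_simps)

text \<open>
  Each use of \<open>f_aux_minus_2\<close> splits off one power of \<open>z\<close> and multiplies the remainder by \<open>-1\<close> and
  the next two factors of the Pochhammer symbol.
\<close>
lemma f_aux_expansion:
  "f_aux a \<zeta> = exp ((a - 1) * \<zeta>) *
      (\<Sum>n<N. (-1) ^ n * pochhammer (1 - a) (2 * n) / exp \<zeta> ^ (2 * n))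
    + (-1) ^ N * pochhammer (1 - a) (2 * N) * f_aux (a - 2 * of_nat N) \<zeta>"
proof (induction N)
  case (Suc N)
  have step: "f_aux (a - 2 * of_nat N) \<zeta> = exp ((a - 1) * \<zeta>) / exp \<zeta> ^ (2 * N)
      - (1 - a + of_nat (2 * N)) * (1 - a + of_nat (2 * N + 1)) * f_aux (a - 2 * of_nat (Suc N)) \<zeta>"
  proof -
    have "(a - 2 * of_nat N - 1) * \<zeta> = (a - 1) * \<zeta> - of_nat (2 * N) * \<zeta>"
      by (simp add: algebra_simps)
    hence "exp ((a - 2 * of_nat N - 1) * \<zeta>) = exp ((a - 1) * \<zeta>) / exp \<zeta> ^ (2 * N)"
      by (simp only: exp_diff exp_of_nat_mult)
    thus ?thesis using f_aux_minus_2[of "a - 2 * of_nat N" \<zeta>] by (simp add: algebra_simps)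
  qed
  have poch: "pochhammer (1 - a) (2 * Suc N)
      = pochhammer (1 - a) (2 * N) * ((1 - a + of_nat (2 * N)) * (1 - a + of_nat (2 * N + 1)))"
    by (simp add: pochhammer_Suc mult.assoc)
  show ?case
    unfolding Suc.IH poch sum.lessThan_Suc by (subst step) (simp add: algebra_simps)
qed simp

theorem proposition1p1:
  fixes a z \<zeta> :: complex and R_f R_g :: "nat \<Rightarrow> complex"
  assumes z: "z = exp \<zeta>"
    and R_f: "\<And>N. f_aux a \<zeta> = exp ((a - 1) * \<zeta>) *
      ((\<Sum>n<N. (-1) ^ n * pochhammer (1 - a) (2 * n) / z ^ (2 * n)) + R_f N)"
    and R_g: "\<And>N. g_aux a \<zeta> = exp ((a - 1) * \<zeta>) *
      ((\<Sum>n<N. (-1) ^ n * pochhammer (1 - a) (2 * n + 1) / z ^ (2 * n + 1)) + R_g N)"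
  shows "(\<forall>N. 2 * real N + 1 > Re a \<longrightarrow>
        R_f N = (-1) ^ N * pochhammer (1 - a) (2 * N) / z ^ (2 * N)
          * basic_terminant (2 * of_nat N + 1 - a) \<zeta>) \<and>
    (\<forall>N. 2 * real N + 2 > Re a \<longrightarrow>
        R_g N = (-1) ^ N * pochhammer (1 - a) (2 * N + 1) / z ^ (2 * N + 1)
          * basic_terminant (2 * of_nat N + 2 - a) \<zeta>)"
proof -
  have z0: "z \<noteq> 0" using z by simp
  \<comment> \<open>\<open>z\<^bsup>m + 1 - a\<^esup>\<close> in the terminant against \<open>z\<^bsup>-m\<^esup>\<close> leaves \<open>z\<^bsup>1 - a\<^esup>\<close>; used with \<open>m = 2N\<close> for
    \<open>f\<close> and \<open>m = 2N + 1\<close> for \<open>g\<close>.\<close>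
  have terminant: "basic_terminant (of_nat m + 1 - a) \<zeta> / z ^ m
      = f_aux (a - of_nat m) \<zeta> / exp ((a - 1) * \<zeta>)" for m
  proof -
    have "exp ((of_nat m + 1 - a) * \<zeta>) = z ^ m / exp ((a - 1) * \<zeta>)"
      unfolding z exp_of_nat_mult[symmetric] exp_diff[symmetric]
      by (rule arg_cong[where f = exp]) (simp add: algebra_simps)
    thus ?thesis using z0 by (simp add: basic_terminant_def)
  qed
  have "R_f N = (-1) ^ N * pochhammer (1 - a) (2 * N) / z ^ (2 * N)
          * basic_terminant (2 * of_nat N + 1 - a) \<zeta>" for N
  proof -
    have "exp ((a - 1) * \<zeta>) * R_f N
        = (-1) ^ N * pochhammer (1 - a) (2 * N) * f_aux (a - of_nat (2 * N)) \<zeta>"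
      using R_f[of N] f_aux_expansion[of a \<zeta> N] by (simp add: z distrib_left)
    hence "R_f N = (-1) ^ N * pochhammer (1 - a) (2 * N)
        * (f_aux (a - of_nat (2 * N)) \<zeta> / exp ((a - 1) * \<zeta>))"
      by (simp add: field_simps)
    moreover have "2 * of_nat N + 1 - a = of_nat (2 * N) + 1 - a" by simp
    ultimately show ?thesis by (simp only: terminant[symmetric] times_divide_eq_left times_divide_eq_right)
  qed
  moreover have "R_g N = (-1) ^ N * pochhammer (1 - a) (2 * N + 1) / z ^ (2 * N + 1)
          * basic_terminant (2 * of_nat N + 2 - a) \<zeta>" for N
  proof -
    have poch: "pochhammer (1 - a) (2 * n + 1) = (1 - a) * pochhammer (1 - (a - 1)) (2 * n)" for n
      by (simp add: pochhammer_rec algebra_simps)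
    have shift: "exp ((a - 1) * \<zeta>) = exp ((a - 1 - 1) * \<zeta>) * z"
      unfolding z exp_add[symmetric] by (rule arg_cong[where f = exp]) (simp add: algebra_simps)
    \<comment> \<open>The series of \<open>g\<close> at \<open>a\<close> is \<open>1 - a\<close> times that of \<open>f\<close> at \<open>a - 1\<close>.\<close>
    have "exp ((a - 1) * \<zeta>) * (\<Sum>n<N. (-1) ^ n * pochhammer (1 - a) (2 * n + 1) / z ^ (2 * n + 1))
        = (1 - a) * (exp ((a - 1 - 1) * \<zeta>) *
            (\<Sum>n<N. (-1) ^ n * pochhammer (1 - (a - 1)) (2 * n) / exp \<zeta> ^ (2 * n)))"
      unfolding shift poch sum_distrib_left
      by (rule sum.cong) (use z0 in \<open>simp_all add: z\<close>)
    moreover have "f_aux (a - 1 - 2 * of_nat N) \<zeta> = f_aux (a - of_nat (2 * N + 1)) \<zeta>"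
      by (simp add: algebra_simps)
    ultimately have "exp ((a - 1) * \<zeta>) * R_g N
        = (-1) ^ N * pochhammer (1 - a) (2 * N + 1) * f_aux (a - of_nat (2 * N + 1)) \<zeta>"
      using R_g[of N] g_aux_eq_f_aux[of a \<zeta>] f_aux_expansion[of "a - 1" \<zeta> N]
      by (simp only: poch distrib_left) (simp add: mult_ac)
    hence "R_g N = (-1) ^ N * pochhammer (1 - a) (2 * N + 1)
        * (f_aux (a - of_nat (2 * N + 1)) \<zeta> / exp ((a - 1) * \<zeta>))"
      by (simp add: field_simps)
    moreover have "2 * of_nat N + 2 - a = of_nat (2 * N + 1) + 1 - a" by simp
    ultimately show ?thesis by (simp only: terminant[symmetric] times_divide_eq_left times_divide_eq_right)
  qed
  ultimately show ?thesis by blast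
qed

end
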